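(* Let $\mathcal{D}\subset\mathbb{R}^{n_{eq}}$ be convex, and consider the degrees of freedom $a\in I$ with stencils $\mathcal{N}_a$, masses $M_a>0$, time step $\Delta t>0$ and antidiffusive fluxes $\mathbf{A}_{a,b}\in\mathbb{R}^{n_{eq}}$ ($a\in I$, $b\in\mathcal{N}_a$) satisfying $\mathbf{A}_{a,b}=-\mathbf{A}_{b,a}$. Assume that the low-order solution satisfies $\mathbf{U}^{LO}_a\in\mathcal{D}$ for all $a\in I$. For all $a\in I$, let $\alpha_{a,b}>0$ ($b\in\mathcal{N}_a$) satisfy $\sum_{b\in\mathcal{N}_a}\alpha_{a,b}=1$, and let $k_{a,b}$ be the largest number in $[0,1]$ such that $$\mathbf{U}^{LO}_a+k_{a,b}\frac{\Delta t}{M_a}\mathbf{A}_{a,b}\in\mathcal{D}.$$ Set $l_{a,b}=l_{b,a}:=\min(\alpha_{a,b}k_{a,b},\,\alpha_{b,a}k_{b,a})$. Then the limited solution $$\mathbf{U}_a:=\mathbf{U}^{LO}_a+\frac{\Delta t}{M_a}\sum_{b\in\mathcal{N}_a}l_{a,b}\mathbf{A}_{a,b}$$ satisfies $\mathbf{U}_a\in\mathcal{D}$ for all $a\in I$.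
   Context: $I$ is the finite set of degrees of freedom $a=(\kappa,i)$ of a conservative discretization of a hyperbolic system of $n_{eq}$ conservation laws ($\kappa$ a mesh element, $i$ a local index). Each $a\in I$ has a finite nonempty stencil $\mathcal{N}_a\subset I$, with $b\in\mathcal{N}_a$ if and only if $a\in\mathcal{N}_b$. The set $\mathcal{D}$ is the intersection of the convex invariant domains under consideration. The antidiffusive fluxes relate the high-order update $\mathbf{U}^{HO}_a$ and the low-order update $\mathbf{U}^{LO}_a$ by $\frac{M_a}{\Delta t}(\mathbf{U}^{HO}_a-\mathbf{U}^{LO}_a)=\sum_{b\in\mathcal{N}_a}\mathbf{A}_{a,b}$. The largest coefficients $k_{a,b}$ are assumed to exist. *)

theory Defs
  imports "HOL-Analysis.Analysis"
begin

text \<open>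
  Degrees of freedom are the elements of a finite set \<open>I\<close> over an arbitrary type \<open>'i\<close> (for instance
  pairs of a mesh element and a local index). Families such as \<open>A\<close>, \<open>\<alpha>\<close>, \<open>k\<close> are total functions;
  only their values at \<open>a \<in> I\<close>, \<open>b \<in> \<N> a\<close> are ever constrained or used.
\<close>

definition stencils :: "'i set \<Rightarrow> ('i \<Rightarrow> 'i set) \<Rightarrow> bool" where
  "stencils I \<N> \<longleftrightarrow>
     (\<forall>a\<in>I. \<N> a \<noteq> {} \<and> \<N> a \<subseteq> I) \<and>
     (\<forall>a\<in>I. \<forall>b\<in>I. b \<in> \<N> a \<longleftrightarrow> a \<in> \<N> b)"

definition antidiffusive_fluxes ::
  "'i set \<Rightarrow> ('i \<Rightarrow> 'i set) \<Rightarrow> ('i \<Rightarrow> real) \<Rightarrow> real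
    \<Rightarrow> ('i \<Rightarrow> real ^ 'n) \<Rightarrow> ('i \<Rightarrow> real ^ 'n) \<Rightarrow> ('i \<Rightarrow> 'i \<Rightarrow> real ^ 'n) \<Rightarrow> bool" where
  "antidiffusive_fluxes I \<N> M dt UHO ULO A \<longleftrightarrow>
     (\<forall>a\<in>I. (M a / dt) *\<^sub>R (UHO a - ULO a) = (\<Sum>b\<in>\<N> a. A a b)) \<and>
     (\<forall>a\<in>I. \<forall>b\<in>\<N> a. A a b = - A b a)"

definition admissible_coeffs ::
  "(real ^ 'n) set \<Rightarrow> ('i \<Rightarrow> real) \<Rightarrow> real \<Rightarrow> ('i \<Rightarrow> real ^ 'n)
    \<Rightarrow> ('i \<Rightarrow> 'i \<Rightarrow> real ^ 'n) \<Rightarrow> 'i \<Rightarrow> 'i \<Rightarrow> real set" where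
  "admissible_coeffs D M dt ULO A a b =
     {k \<in> {0..1}. ULO a + (k * (dt / M a)) *\<^sub>R A a b \<in> D}"

definition is_largest :: "real set \<Rightarrow> real \<Rightarrow> bool" where
  "is_largest S m \<longleftrightarrow> m \<in> S \<and> (\<forall>x\<in>S. x \<le> m)"

definition limiter :: "('i \<Rightarrow> 'i \<Rightarrow> real) \<Rightarrow> ('i \<Rightarrow> 'i \<Rightarrow> real) \<Rightarrow> 'i \<Rightarrow> 'i \<Rightarrow> real" where
  "limiter \<alpha> k a b = min (\<alpha> a b * k a b) (\<alpha> b a * k b a)"

definition limited_solution ::
  "('i \<Rightarrow> 'i set) \<Rightarrow> ('i \<Rightarrow> real) \<Rightarrow> real \<Rightarrow> ('i \<Rightarrow> real ^ 'n)
    \<Rightarrow> ('i \<Rightarrow> 'i \<Rightarrow> real ^ 'n) \<Rightarrow> ('i \<Rightarrow> 'i \<Rightarrow> real) \<Rightarrow> 'i \<Rightarrow> real ^ 'n" where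
  "limited_solution \<N> M dt ULO A l a =
     ULO a + (dt / M a) *\<^sub>R (\<Sum>b\<in>\<N> a. l a b *\<^sub>R A a b)"

end

theory Submission
  imports Defs
begin

text \<open>
  Since the \<open>\<alpha> a b\<close> are weights summing to one, the limited solution at \<open>a\<close> is the convex
  combination with weights \<open>\<alpha> a b\<close> of the states
  \<open>ULO a + (l a b / \<alpha> a b) (dt / M a) A a b\<close>. As \<open>0 \<le> l a b / \<alpha> a b \<le> k a b\<close>, each of these
  lies on the segment from \<open>ULO a\<close> to the admissible state with coefficient \<open>k a b\<close>, hence in \<open>D\<close>.
\<close>

text \<open>For \<open>k > 0\<close> the point is the convex combination of \<open>u\<close> and the
  given endpoint with weights \<open>1 - s / k\<close> and \<open>s / k\<close>.\<close>

lemma convex_add_scaleR_mem: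
  fixes u v :: "'a::real_vector"
  assumes D: "convex D" and u: "u \<in> D" and v: "u + k *\<^sub>R v \<in> D"
    and s: "0 \<le> s" "s \<le> k"
  shows "u + s *\<^sub>R v \<in> D"
\<comment> \<open>The weight \<open>s / k\<close> needs \<open>k\<close> nonzero;
  \<open>k = 0\<close> forces \<open>s = 0\<close>, leaving \<open>u\<close> itself.\<close>
proof (cases "k = 0")
  case True
  then show ?thesis using s u by simp
next
  case False
  then have k: "k > 0" using s by simp
  have "(1 - s / k) *\<^sub>R u + (s / k) *\<^sub>R (u + k *\<^sub>R v) \<in> D"
    using D u v s k by (intro convexD) auto
  also have "(1 - s / k) *\<^sub>R u + (s / k) *\<^sub>R (u + k *\<^sub>R v) = u + s *\<^sub>R v"
    using k by (simp add: algebra_simps)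
  finally show ?thesis .
qed

text \<open>The averaging argument at one fixed degree of freedom, with \<open>v b\<close> in the
  role of the scaled flux. Dividing \<open>l b\<close> by its weight turns the bound
  \<open>w b * k b\<close> into \<open>k b\<close>, so each summand falls under the segment
  lemma.\<close>

lemma convex_add_sum_mem:
  fixes u :: "'a::real_vector"
  assumes D: "convex D" and S: "finite S" and u: "u \<in> D"
    and w: "\<And>b. b \<in> S \<Longrightarrow> w b > 0" "sum w S = 1"
    and k: "\<And>b. b \<in> S \<Longrightarrow> u + k b *\<^sub>R v b \<in> D"
    and l: "\<And>b. b \<in> S \<Longrightarrow> 0 \<le> l b" "\<And>b. b \<in> S \<Longrightarrow> l b \<le> w b * k b"
  shows "u + (\<Sum>b\<in>S. l b *\<^sub>R v b) \<in> D"
proof -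
  have "(\<Sum>b\<in>S. w b *\<^sub>R (u + (l b / w b) *\<^sub>R v b)) \<in> D"
  proof (rule convex_sum[OF S D w(2)])
    fix b assume b: "b \<in> S"
    show "0 \<le> w b" using w(1)[OF b] by simp
    show "u + (l b / w b) *\<^sub>R v b \<in> D"
    proof (rule convex_add_scaleR_mem[OF D u k[OF b]])
      show "0 \<le> l b / w b" "l b / w b \<le> k b"
        using w(1)[OF b] l[OF b] by (simp_all add: field_simps)
    qed
  qed
  also have "(\<Sum>b\<in>S. w b *\<^sub>R (u + (l b / w b) *\<^sub>R v b)) = (\<Sum>b\<in>S. w b *\<^sub>R u + l b *\<^sub>R v b)"
    by (rule sum.cong) (use w(1) in \<open>force simp: scaleR_add_right\<close>)+
  \<comment> \<open>Since the weights sum to one, the multiples of \<open>u\<close> add up to a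
    single \<open>u\<close>.\<close>
  also have "\<dots> = u + (\<Sum>b\<in>S. l b *\<^sub>R v b)"
    using w(2) by (simp add: sum.distrib flip: scaleR_sum_left)
  finally show ?thesis .
qed

theorem mainTheorem1:
  fixes D :: "(real ^ 'n) set"
    and I :: "'i set"
    and \<N> :: "'i \<Rightarrow> 'i set"
    and M :: "'i \<Rightarrow> real"
    and dt :: real
    and ULO UHO :: "'i \<Rightarrow> real ^ 'n"
    and A :: "'i \<Rightarrow> 'i \<Rightarrow> real ^ 'n"
    and \<alpha> k :: "'i \<Rightarrow> 'i \<Rightarrow> real"
  assumes "convex D"
    and "finite I"
    and "stencils I \<N>"
    and "\<And>a. a \<in> I \<Longrightarrow> M a > 0"
    and "dt > 0"
    and "antidiffusive_fluxes I \<N> M dt UHO ULO A"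
    and "\<And>a. a \<in> I \<Longrightarrow> ULO a \<in> D"
    and "\<And>a b. a \<in> I \<Longrightarrow> b \<in> \<N> a \<Longrightarrow> \<alpha> a b > 0"
    and "\<And>a. a \<in> I \<Longrightarrow> (\<Sum>b\<in>\<N> a. \<alpha> a b) = 1"
    and "\<And>a b. a \<in> I \<Longrightarrow> b \<in> \<N> a \<Longrightarrow>
           is_largest (admissible_coeffs D M dt ULO A a b) (k a b)"
  shows "\<forall>a\<in>I. limited_solution \<N> M dt ULO A (limiter \<alpha> k) a \<in> D"
proof
  fix a assume a: "a \<in> I"
  have sub: "\<N> a \<subseteq> I" and sym: "\<And>b. b \<in> \<N> a \<Longrightarrow> a \<in> \<N> b"
    using assms(3) a by (auto simp: stencils_def)
  \<comment> \<open>Kept general in \<open>c\<close> because the limiter at the pair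
    \<open>a\<close>, \<open>b\<close> also involves \<open>k b a\<close>.\<close>
  have k: "0 \<le> k c b" "ULO c + (k c b * (dt / M c)) *\<^sub>R A c b \<in> D"
    if "c \<in> I" "b \<in> \<N> c" for c b
    using assms(10)[OF that] by (auto simp: is_largest_def admissible_coeffs_def)
  have "ULO a + (\<Sum>b\<in>\<N> a. limiter \<alpha> k a b *\<^sub>R ((dt / M a) *\<^sub>R A a b)) \<in> D"
  proof (rule convex_add_sum_mem[where w = "\<alpha> a" and k = "k a"])
    show "convex D" "finite (\<N> a)" "ULO a \<in> D" "sum (\<alpha> a) (\<N> a) = 1"
      using assms(1,2,7,9) a sub by (auto intro: finite_subset)
  next
    fix b assume b: "b \<in> \<N> a"
    then have b': "b \<in> I" "a \<in> \<N> b" using sub sym by auto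
    show "\<alpha> a b > 0" using assms(8) a b by blast
    show "ULO a + k a b *\<^sub>R ((dt / M a) *\<^sub>R A a b) \<in> D" using k(2)[OF a b] by simp
    \<comment> \<open>Both arguments of the minimum must be nonnegative; the one for the reversed
      pair is controlled through the symmetry of the stencils.\<close>
    show "0 \<le> limiter \<alpha> k a b"
      using k(1)[OF a b] k(1)[OF b'] assms(8)[OF a b] assms(8)[OF b']
      by (simp add: limiter_def)
    show "limiter \<alpha> k a b \<le> \<alpha> a b * k a b" by (simp add: limiter_def)
  qed
  then show "limited_solution \<N> M dt ULO A (limiter \<alpha> k) a \<in> D"
    by (simp add: limited_solution_def scaleR_sum_right mult.commute)
qed

end
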